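(* Let $(M,g)$ be a smooth Riemannian manifold and let $\mathcal{D}\subseteq TM$ be a regular distribution. Then $\mathcal{D}$ is involutive if and only if its second fundamental form $B$ is symmetric, i.e. $B(X,Y)=B(Y,X)$ for all $X,Y\in\Gamma(\mathcal{D})$.
   Context: All objects are $\mathcal{C}^\infty$. $(M,g)$ is a Riemannian manifold with Levi-Civita connection $\nabla$. A regular distribution $\mathcal{D}\subseteq TM$ is a smooth subbundle of $TM$ of constant rank; $\mathcal{D}^{\bot}$ is its $g$-orthogonal complement; $\Gamma(\cdot)$ denotes the module of smooth sections; $\pi^{\mathcal{D}^{\bot}}:TM\to\mathcal{D}^{\bot}$ is the orthogonal projection. The second fundamental form of $\mathcal{D}$ is $B(X,Y)=\pi^{\mathcal{D}^{\bot}}(\nabla_XY)$ for $X,Y\in\Gamma(\mathcal{D})$. $\mathcal{D}$ is involutive if $[X,Y]\in\Gamma(\mathcal{D})$ for all $X,Y\in\Gamma(\mathcal{D})$. *)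

theory Defs
  imports "HOL-Analysis.Analysis" "HOL-Library.Function_Algebras"
begin

text \<open>Functions into a real vector space form a real vector space pointwise. The additive
  structure is that of \<^theory>\<open>HOL-Library.Function_Algebras\<close>; on real functions that theory also
  provides the pointwise product. This makes \<^const>\<open>span\<close>, \<^const>\<open>dim\<close> and \<^const>\<open>subspace\<close>
  available for tangent vectors, which below are functionals on smooth functions.\<close>

instantiation "fun" :: (type, real_vector) real_vector
begin

definition scaleR_fun :: "real \<Rightarrow> ('a \<Rightarrow> 'b) \<Rightarrow> 'a \<Rightarrow> 'b" where
  "scaleR_fun c f = (\<lambda>x. c *\<^sub>R f x)"

instance
  by standard (simp_all add: scaleR_fun_def fun_eq_iff scaleR_add_right scaleR_add_left)

end


section \<open>Smooth manifolds\<close>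

text \<open>The coordinate space is \<^term>\<open>Euclidean_space n\<close>, whose points are the sequences vanishing
  from index \<open>n\<close> on; \<open>n = 0\<close> is allowed.\<close>

definition partial_deriv :: "nat \<Rightarrow> ((nat \<Rightarrow> real) \<Rightarrow> real) \<Rightarrow> (nat \<Rightarrow> real) \<Rightarrow> real" where
  "partial_deriv i f x = deriv (\<lambda>t. f (x(i := t))) (x i)"

text \<open>Only meant for \<open>S\<close> open in \<^term>\<open>Euclidean_space n\<close>.\<close>

primrec Ck_on :: "nat \<Rightarrow> nat \<Rightarrow> (nat \<Rightarrow> real) set \<Rightarrow> ((nat \<Rightarrow> real) \<Rightarrow> real) \<Rightarrow> bool" where
  "Ck_on n 0 S f \<longleftrightarrow> continuous_map (subtopology (Euclidean_space n) S) euclideanreal f"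
| "Ck_on n (Suc k) S f \<longleftrightarrow>
     continuous_map (subtopology (Euclidean_space n) S) euclideanreal f \<and>
     (\<forall>i<n. (\<forall>x\<in>S. (\<lambda>t. f (x(i := t))) differentiable (at (x i))) \<and>
            Ck_on n k S (partial_deriv i f))"

definition smooth_real_on :: "nat \<Rightarrow> (nat \<Rightarrow> real) set \<Rightarrow> ((nat \<Rightarrow> real) \<Rightarrow> real) \<Rightarrow> bool" where
  "smooth_real_on n S f \<longleftrightarrow> (\<forall>k. Ck_on n k S f)"

type_synonym 'a chart = "'a set \<times> ('a \<Rightarrow> nat \<Rightarrow> real)"

record 'a manifold =
  mtop :: "'a topology"
  mdim :: nat
  atlas :: "'a chart set"

abbreviation points :: "'a manifold \<Rightarrow> 'a set" where
  "points M \<equiv> topspace (mtop M)"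

definition is_chart :: "'a topology \<Rightarrow> nat \<Rightarrow> 'a chart \<Rightarrow> bool" where
  "is_chart T n = (\<lambda>(U, \<phi>).
     openin T U \<and> openin (Euclidean_space n) (\<phi> ` U) \<and>
     homeomorphic_map (subtopology T U) (subtopology (Euclidean_space n) (\<phi> ` U)) \<phi>)"

definition smooth_transition :: "nat \<Rightarrow> 'a chart \<Rightarrow> 'a chart \<Rightarrow> bool" where
  "smooth_transition n = (\<lambda>(U, \<phi>) (V, \<psi>).
     \<forall>i<n. smooth_real_on n (\<phi> ` (U \<inter> V)) (\<lambda>x. \<psi> (inv_into U \<phi> x) i))"

definition smooth_manifold :: "'a manifold \<Rightarrow> bool" where
  "smooth_manifold M \<longleftrightarrow>
     Hausdorff_space (mtop M) \<and> second_countable (mtop M) \<and>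
     (\<forall>c\<in>atlas M. is_chart (mtop M) (mdim M) c) \<and>
     (\<Union>c\<in>atlas M. fst c) = points M \<and>
     (\<forall>c\<in>atlas M. \<forall>d\<in>atlas M. smooth_transition (mdim M) c d)"

definition smooth_fun_on :: "'a manifold \<Rightarrow> 'a set \<Rightarrow> ('a \<Rightarrow> real) \<Rightarrow> bool" where
  "smooth_fun_on M U f \<longleftrightarrow>
     (\<forall>(V, \<phi>)\<in>atlas M. smooth_real_on (mdim M) (\<phi> ` (U \<inter> V)) (\<lambda>x. f (inv_into V \<phi> x)))"

text \<open>Functions on the manifold and vector fields are represented by functions on the whole type
  that vanish off the carrier, so that equality of functions is equality on the manifold.\<close>

definition smooth_functions :: "'a manifold \<Rightarrow> ('a \<Rightarrow> real) set" where
  "smooth_functions M = {f. smooth_fun_on M (points M) f \<and> (\<forall>p. p \<notin> points M \<longrightarrow> f p = 0)}"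


section \<open>Tangent vectors and vector fields\<close>

type_synonym 'a tangent = "('a \<Rightarrow> real) \<Rightarrow> real"
type_synonym 'a vfield = "'a \<Rightarrow> 'a tangent"

text \<open>Tangent vectors at \<open>p\<close> are the derivations at \<open>p\<close> of the algebra of smooth functions, with
  junk value \<open>0\<close> on functions that are not smooth.\<close>

definition tangent_space :: "'a manifold \<Rightarrow> 'a \<Rightarrow> 'a tangent set" where
  "tangent_space M p = {v.
     (\<forall>f\<in>smooth_functions M. \<forall>h\<in>smooth_functions M. v (f + h) = v f + v h) \<and>
     (\<forall>c. \<forall>f\<in>smooth_functions M. v (c *\<^sub>R f) = c * v f) \<and>
     (\<forall>f\<in>smooth_functions M. \<forall>h\<in>smooth_functions M. v (f * h) = f p * v h + h p * v f) \<and>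
     (\<forall>f. f \<notin> smooth_functions M \<longrightarrow> v f = 0)}"

definition smooth_vfield_on :: "'a manifold \<Rightarrow> 'a set \<Rightarrow> 'a vfield \<Rightarrow> bool" where
  "smooth_vfield_on M U X \<longleftrightarrow>
     (\<forall>p\<in>U. X p \<in> tangent_space M p) \<and>
     (\<forall>f\<in>smooth_functions M. smooth_fun_on M U (\<lambda>p. X p f))"

definition vector_fields :: "'a manifold \<Rightarrow> 'a vfield set" where
  "vector_fields M =
     {X. smooth_vfield_on M (points M) X \<and> (\<forall>p. p \<notin> points M \<longrightarrow> X p = 0)}"

definition vf_apply :: "'a vfield \<Rightarrow> ('a \<Rightarrow> real) \<Rightarrow> 'a \<Rightarrow> real" where
  "vf_apply X f = (\<lambda>p. X p f)"

definition vf_scale :: "('a \<Rightarrow> real) \<Rightarrow> 'a vfield \<Rightarrow> 'a vfield" where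
  "vf_scale f X = (\<lambda>p. f p *\<^sub>R X p)"

definition lie_bracket :: "'a vfield \<Rightarrow> 'a vfield \<Rightarrow> 'a vfield" where
  "lie_bracket X Y = (\<lambda>p f. X p (vf_apply Y f) - Y p (vf_apply X f))"


section \<open>Riemannian metrics and the Levi-Civita connection\<close>

definition metric_apply ::
  "'a manifold \<Rightarrow> ('a \<Rightarrow> 'a tangent \<Rightarrow> 'a tangent \<Rightarrow> real) \<Rightarrow> 'a vfield \<Rightarrow> 'a vfield \<Rightarrow> 'a \<Rightarrow> real"
  where "metric_apply M g X Y = (\<lambda>p. if p \<in> points M then g p (X p) (Y p) else 0)"

definition riemannian_metric ::
  "'a manifold \<Rightarrow> ('a \<Rightarrow> 'a tangent \<Rightarrow> 'a tangent \<Rightarrow> real) \<Rightarrow> bool" where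
  "riemannian_metric M g \<longleftrightarrow>
     (\<forall>p\<in>points M.
        (\<forall>u\<in>tangent_space M p. \<forall>v\<in>tangent_space M p. \<forall>w\<in>tangent_space M p.
           g p (u + v) w = g p u w + g p v w) \<and>
        (\<forall>c. \<forall>u\<in>tangent_space M p. \<forall>w\<in>tangent_space M p. g p (c *\<^sub>R u) w = c * g p u w) \<and>
        (\<forall>u\<in>tangent_space M p. \<forall>v\<in>tangent_space M p. g p u v = g p v u) \<and>
        (\<forall>u\<in>tangent_space M p. u \<noteq> 0 \<longrightarrow> g p u u > 0)) \<and>
     (\<forall>X\<in>vector_fields M. \<forall>Y\<in>vector_fields M. metric_apply M g X Y \<in> smooth_functions M)"

definition affine_connection :: "'a manifold \<Rightarrow> ('a vfield \<Rightarrow> 'a vfield \<Rightarrow> 'a vfield) \<Rightarrow> bool" where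
  "affine_connection M nabla \<longleftrightarrow>
     (\<forall>X\<in>vector_fields M. \<forall>Y\<in>vector_fields M. nabla X Y \<in> vector_fields M) \<and>
     (\<forall>X\<in>vector_fields M. \<forall>Y\<in>vector_fields M. \<forall>Z\<in>vector_fields M.
        nabla (X + Y) Z = nabla X Z + nabla Y Z \<and>
        nabla X (Y + Z) = nabla X Y + nabla X Z) \<and>
     (\<forall>f\<in>smooth_functions M. \<forall>X\<in>vector_fields M. \<forall>Y\<in>vector_fields M.
        nabla (vf_scale f X) Y = vf_scale f (nabla X Y) \<and>
        nabla X (vf_scale f Y) = vf_scale (vf_apply X f) Y + vf_scale f (nabla X Y))"

definition levi_civita_connection ::
  "'a manifold \<Rightarrow> ('a \<Rightarrow> 'a tangent \<Rightarrow> 'a tangent \<Rightarrow> real) \<Rightarrow>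
   ('a vfield \<Rightarrow> 'a vfield \<Rightarrow> 'a vfield) \<Rightarrow> bool" where
  "levi_civita_connection M g nabla \<longleftrightarrow>
     affine_connection M nabla \<and>
     (\<forall>X\<in>vector_fields M. \<forall>Y\<in>vector_fields M. nabla X Y - nabla Y X = lie_bracket X Y) \<and>
     (\<forall>X\<in>vector_fields M. \<forall>Y\<in>vector_fields M. \<forall>Z\<in>vector_fields M.
        vf_apply X (metric_apply M g Y Z) =
        metric_apply M g (nabla X Y) Z + metric_apply M g Y (nabla X Z))"


section \<open>Distributions\<close>

text \<open>A smooth subbundle of constant rank \<open>k\<close>: rank-\<open>k\<close> subspaces of the tangent spaces admitting
  smooth local frames (\<open>k\<close> spanning fields of a \<open>k\<close>-dimensional space are a basis).\<close>

definition regular_distribution :: "'a manifold \<Rightarrow> ('a \<Rightarrow> 'a tangent set) \<Rightarrow> bool" where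
  "regular_distribution M D \<longleftrightarrow>
     (\<exists>k::nat.
        (\<forall>p\<in>points M. subspace (D p) \<and> D p \<subseteq> tangent_space M p \<and> dim (D p) = k) \<and>
        (\<forall>p\<in>points M. \<exists>U X. openin (mtop M) U \<and> p \<in> U \<and>
           (\<forall>i<k. smooth_vfield_on M U (X i)) \<and>
           (\<forall>q\<in>U. D q = span ((\<lambda>i. X i q) ` {..<k}))))"

definition sections :: "'a manifold \<Rightarrow> ('a \<Rightarrow> 'a tangent set) \<Rightarrow> 'a vfield set" where
  "sections M D = {X \<in> vector_fields M. \<forall>p\<in>points M. X p \<in> D p}"

definition involutive :: "'a manifold \<Rightarrow> ('a \<Rightarrow> 'a tangent set) \<Rightarrow> bool" where
  "involutive M D \<longleftrightarrow>
     (\<forall>X\<in>sections M D. \<forall>Y\<in>sections M D. lie_bracket X Y \<in> sections M D)"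

definition perp ::
  "'a manifold \<Rightarrow> ('a \<Rightarrow> 'a tangent \<Rightarrow> 'a tangent \<Rightarrow> real) \<Rightarrow>
   ('a \<Rightarrow> 'a tangent set) \<Rightarrow> 'a \<Rightarrow> 'a tangent set" where
  "perp M g D p = {v \<in> tangent_space M p. \<forall>w\<in>D p. g p v w = 0}"

text \<open>The component in \<open>perp M g D p\<close> of the orthogonal decomposition of the tangent space into
  \<open>D p\<close> and \<open>perp M g D p\<close>.\<close>

definition proj_perp ::
  "'a manifold \<Rightarrow> ('a \<Rightarrow> 'a tangent \<Rightarrow> 'a tangent \<Rightarrow> real) \<Rightarrow>
   ('a \<Rightarrow> 'a tangent set) \<Rightarrow> 'a \<Rightarrow> 'a tangent \<Rightarrow> 'a tangent" where
  "proj_perp M g D p v = (THE w. w \<in> perp M g D p \<and> v - w \<in> D p)"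

definition second_fundamental_form ::
  "'a manifold \<Rightarrow> ('a \<Rightarrow> 'a tangent \<Rightarrow> 'a tangent \<Rightarrow> real) \<Rightarrow>
   ('a vfield \<Rightarrow> 'a vfield \<Rightarrow> 'a vfield) \<Rightarrow> ('a \<Rightarrow> 'a tangent set) \<Rightarrow>
   'a vfield \<Rightarrow> 'a vfield \<Rightarrow> 'a vfield" where
  "second_fundamental_form M g nabla D X Y =
     (\<lambda>p. if p \<in> points M then proj_perp M g D p (nabla X Y p) else 0)"

end

theory Submission
  imports Defs
begin

text \<open>Since \<open>\<nabla>\<close> is torsion free, \<open>B(X,Y) - B(Y,X)\<close> is the normal component of \<open>[X,Y]\<close>. Each
  \<open>D p\<close> is finite dimensional and \<open>g p\<close> is positive definite, so the orthogonal decomposition exists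
  and is unique; hence this component vanishes at \<open>p\<close> exactly if \<open>[X,Y]\<close> lies in \<open>D p\<close>.\<close>

section \<open>Differences of smooth functions and of smooth vector fields\<close>

lemma eventually_fun_upd_openin_Euclidean_space:
  assumes S: "openin (Euclidean_space n) S" and x: "x \<in> S" and i: "i < n"
  shows "eventually (\<lambda>t. x(i := t) \<in> S) (nhds (x i))"
proof -
  have xE: "x \<in> topspace (Euclidean_space n)"
    using S x openin_subset by blast
  have "continuous_map euclideanreal (Euclidean_space n) (\<lambda>t. x(i := t))"
    unfolding Euclidean_space_def
  proof (rule continuous_map_into_subtopology)
    show "continuous_map euclideanreal (powertop_real UNIV) (\<lambda>t. x(i := t))"
      by (auto simp: continuous_map_componentwise_UNIV)
    \<comment> \<open>\<open>i < n\<close> keeps the updated sequence zero from index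
      \<open>n\<close> on.\<close>
    show "(\<lambda>t. x(i := t)) \<in> topspace euclideanreal \<rightarrow> {x. \<forall>i\<ge>n. x i = 0}"
      using xE i by (auto simp: topspace_Euclidean_space)
  qed
  then have "open {t. x(i := t) \<in> S}"
    using S by (auto simp: continuous_map_def)
  then show ?thesis
    using x by (auto simp: eventually_nhds)
qed

text \<open>Openness of \<open>S\<close> is essential: through a point of \<open>S\<close>, a short
  piece of each coordinate line stays in \<open>S\<close>, so both functions agree near the point
  along it and have the same partial derivative there.\<close>

lemma Ck_on_cong:
  assumes "openin (Euclidean_space n) S" and "Ck_on n k S f" and "\<And>x. x \<in> S \<Longrightarrow> f x = h x"
  shows "Ck_on n k S h"
  using assms(2,3)
proof (induction k arbitrary: f h)
  case 0
  then show ?case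
    by (auto intro: continuous_map_eq)
next
  case (Suc k)
  have cont: "continuous_map (subtopology (Euclidean_space n) S) euclideanreal h"
    using Suc.prems by (auto intro: continuous_map_eq)
  have ev: "eventually (\<lambda>t. f (x(i := t)) = h (x(i := t))) (nhds (x i))" if "i < n" "x \<in> S" for i x
    using eventually_fun_upd_openin_Euclidean_space[OF assms(1) that(2,1)]
    by eventually_elim (rule Suc.prems(2))
  have "(\<lambda>t. h (x(i := t))) differentiable at (x i)" if i: "i < n" and x: "x \<in> S" for i x
  proof -
    have "(\<lambda>t. f (x(i := t))) differentiable at (x i)"
      using Suc.prems i x by simp
    then show ?thesis
      using DERIV_cong_ev[OF refl ev[OF i x] refl] unfolding real_differentiable_def by blast
  qed
  moreover have "Ck_on n k S (partial_deriv i h)" if "i < n" for i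
  proof (rule Suc.IH)
    show "Ck_on n k S (partial_deriv i f)"
      using Suc.prems that by simp
    show "partial_deriv i f x = partial_deriv i h x" if "x \<in> S" for x
      unfolding partial_deriv_def by (rule deriv_cong_ev[OF ev[OF \<open>i < n\<close> that] refl])
  qed
  ultimately show ?case
    using cont by simp
qed

lemma Ck_on_diff:
  assumes "openin (Euclidean_space n) S" and "Ck_on n k S f" and "Ck_on n k S h"
  shows "Ck_on n k S (\<lambda>x. f x - h x)"
  using assms(2,3)
proof (induction k arbitrary: f h)
  case 0
  then show ?case
    by (auto intro: continuous_map_diff)
next
  case (Suc k)
  have cont: "continuous_map (subtopology (Euclidean_space n) S) euclideanreal (\<lambda>x. f x - h x)"
    using Suc.prems by (auto intro: continuous_map_diff)
  have diff: "(\<lambda>t. f (x(i := t))) differentiable at (x i)"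
    "(\<lambda>t. h (x(i := t))) differentiable at (x i)" if "i < n" "x \<in> S" for i x
    using Suc.prems that by auto
  have "Ck_on n k S (partial_deriv i (\<lambda>x. f x - h x))" if i: "i < n" for i
  \<comment> \<open>The partial derivative of the difference is known to split only at points of
    \<open>S\<close>, where both slices are differentiable; hence the passage through
    \<open>Ck_on_cong\<close>.\<close>
  proof (rule Ck_on_cong[OF assms(1)])
    show "Ck_on n k S (\<lambda>x. partial_deriv i f x - partial_deriv i h x)"
      using Suc that by simp
    show "partial_deriv i f x - partial_deriv i h x = partial_deriv i (\<lambda>x. f x - h x) x"
      if "x \<in> S" for x
      using diff[OF i that] unfolding partial_deriv_def
      by (intro DERIV_imp_deriv[symmetric] DERIV_diff) (simp_all add: DERIV_deriv_iff_real_differentiable)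
  qed
  then show ?case
    using cont diff by (auto intro: differentiable_diff)
qed

lemma smooth_fun_on_diff:
  assumes M: "smooth_manifold M" and f: "smooth_fun_on M (points M) f"
    and h: "smooth_fun_on M (points M) h"
  shows "smooth_fun_on M (points M) (\<lambda>p. f p - h p)"
  unfolding smooth_fun_on_def smooth_real_on_def
proof (clarify)
  fix V \<phi> k
  assume c: "(V, \<phi>) \<in> atlas M"
  then have "is_chart (mtop M) (mdim M) (V, \<phi>)"
    using M unfolding smooth_manifold_def by blast
  then have V: "openin (mtop M) V" "openin (Euclidean_space (mdim M)) (\<phi> ` V)"
    by (auto simp: is_chart_def)
  \<comment> \<open>So the coordinate domain is the whole image of the chart, which is open as
    \<open>Ck_on_diff\<close> requires.\<close>
  then have "points M \<inter> V = V"
    using openin_subset by blast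
  then show "Ck_on (mdim M) k (\<phi> ` (points M \<inter> V)) (\<lambda>x. f (inv_into V \<phi> x) - h (inv_into V \<phi> x))"
    using V f h c unfolding smooth_fun_on_def smooth_real_on_def
    by (intro Ck_on_diff) auto
qed

lemma subspace_tangent_space: "subspace (tangent_space M p)"
  by (auto simp: subspace_def tangent_space_def scaleR_fun_def algebra_simps)

text \<open>Applied to \<open>nabla X Y\<close> and \<open>nabla Y X\<close>, this makes the Lie
  bracket a smooth vector field without a computation with second derivatives.\<close>

lemma vector_fields_diff:
  assumes "smooth_manifold M" and X: "X \<in> vector_fields M" and Y: "Y \<in> vector_fields M"
  shows "X - Y \<in> vector_fields M"
proof -
  have "(X - Y) p \<in> tangent_space M p" if "p \<in> points M" for p
    using X Y that subspace_diff[OF subspace_tangent_space, of "X p" M p "Y p"]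
    by (simp add: vector_fields_def smooth_vfield_on_def)
  moreover have "smooth_fun_on M (points M) (\<lambda>p. (X - Y) p f)" if "f \<in> smooth_functions M" for f
    using X Y that smooth_fun_on_diff[OF assms(1), of "\<lambda>p. X p f" "\<lambda>p. Y p f"]
    by (simp add: vector_fields_def smooth_vfield_on_def)
  moreover have "(X - Y) p = 0" if "p \<notin> points M" for p
    using X Y that by (simp add: vector_fields_def)
  ultimately show ?thesis
    unfolding vector_fields_def smooth_vfield_on_def by blast
qed

section \<open>Orthogonal decomposition with respect to a finitely spanned subspace\<close>

text \<open>Tangent spaces are subsets of a function type and the metric is constrained only on
  them, so the inner product axioms are relativised to a subspace \<open>V\<close>.\<close>

locale partial_inner_product =
  fixes V :: "'v::real_vector set" and ip :: "'v \<Rightarrow> 'v \<Rightarrow> real"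
  assumes subspace_V: "subspace V"
    and add_left: "\<lbrakk>u \<in> V; v \<in> V; w \<in> V\<rbrakk> \<Longrightarrow> ip (u + v) w = ip u w + ip v w"
    and scaleR_left: "\<lbrakk>u \<in> V; w \<in> V\<rbrakk> \<Longrightarrow> ip (c *\<^sub>R u) w = c * ip u w"
    and commute: "\<lbrakk>u \<in> V; v \<in> V\<rbrakk> \<Longrightarrow> ip u v = ip v u"
    and pos: "\<lbrakk>u \<in> V; u \<noteq> 0\<rbrakk> \<Longrightarrow> ip u u > 0"
begin

lemma diff_left:
  assumes "u \<in> V" "v \<in> V" "w \<in> V"
  shows "ip (u - v) w = ip u w - ip v w"
  using add_left[of "u - v" v w] assms subspace_diff[OF subspace_V] by simp

lemma scaleR_right:
  assumes "u \<in> V" "w \<in> V"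
  shows "ip w (c *\<^sub>R u) = c * ip w u"
  using assms commute[of w "c *\<^sub>R u"] commute[of w u] scaleR_left[of u w c]
    subspace_scale[OF subspace_V]
  by simp

lemma add_right:
  assumes "u \<in> V" "v \<in> V" "w \<in> V"
  shows "ip w (u + v) = ip w u + ip w v"
  using assms commute[of w "u + v"] commute[of w u] commute[of w v] add_left[of u v w]
    subspace_add[OF subspace_V]
  by simp

text \<open>The difference of two candidates lies in \<open>W\<close> and is orthogonal to
  \<open>W\<close>, hence to itself, so positivity makes it zero.\<close>

lemma orthogonal_unique:
  assumes W: "subspace W" "W \<subseteq> V" and "v - w \<in> W" "v - w' \<in> W" and "w \<in> V" "w' \<in> V"
    and "\<forall>u\<in>W. ip w u = 0" "\<forall>u\<in>W. ip w' u = 0"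
  shows "w = w'"
proof -
  have "w - w' \<in> W"
    using subspace_diff[OF W(1) assms(4,3)] by simp
  then have "ip (w - w') (w - w') = 0" "w - w' \<in> V"
    using assms diff_left[of w w' "w - w'"] by (auto simp: subset_iff)
  then show ?thesis
    using pos[of "w - w'"] by fastforce
qed

text \<open>Gram-Schmidt by induction on the spanning set \<open>B\<close>, which may be linearly
  dependent.\<close>

lemma orthogonal_exists:
  assumes "finite B" "B \<subseteq> V" "v \<in> V"
  shows "\<exists>w\<in>V. v - w \<in> span B \<and> (\<forall>u\<in>span B. ip w u = 0)"
  using assms
proof (induction B arbitrary: v rule: finite_induct)
  case empty
  \<comment> \<open>The span of the empty set is \<open>{0}\<close>, so \<open>v\<close> itself is
    the witness.\<close>
  have "ip v 0 = 0"
    using scaleR_right[of 0 v 0] empty subspace_0[OF subspace_V] by simp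
  then show ?case
    using empty by auto
next
  case (insert b B)
  obtain w where w: "w \<in> V" "v - w \<in> span B" "\<And>u. u \<in> span B \<Longrightarrow> ip w u = 0"
    using insert.IH[of v] insert.prems by blast
  \<comment> \<open>The induction hypothesis is used a second time, on the new vector:
    \<open>e\<close> is the part of \<open>b\<close> orthogonal to \<open>span B\<close>. It is zero
    when \<open>b\<close> already lies in \<open>span B\<close>.\<close>
  obtain e where e: "e \<in> V" "b - e \<in> span B" "\<And>u. u \<in> span B \<Longrightarrow> ip e u = 0"
    using insert.IH[of b] insert.prems by blast
  \<comment> \<open>Subtracting \<open>c *\<^sub>R e\<close> removes the component of
    \<open>w\<close> along \<open>e\<close>. If \<open>e = 0\<close>, nothing is subtracted,
    whatever the value of the quotient.\<close>
  define c where "c = ip w e / ip e e"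
  let ?w = "w - c *\<^sub>R e"
  have spanV: "span B \<subseteq> V"
    using insert.prems by (intro span_minimal subspace_V) auto
  have ceV: "c *\<^sub>R e \<in> V"
    using e subspace_scale[OF subspace_V] by blast
  have wV: "?w \<in> V"
    using w ceV subspace_diff[OF subspace_V] by blast
  have we: "ip ?w e = 0"
  proof (cases "e = 0")
    case True
    then show ?thesis
      using scaleR_right[of 0 w 0] w subspace_0[OF subspace_V] by simp
  next
    case False
    then show ?thesis
      using pos[OF e(1)] diff_left[OF w(1) ceV e(1)] scaleR_left[OF e(1) e(1)]
      by (simp add: c_def)
  qed
  have wB: "ip ?w u = 0" if "u \<in> span B" for u
    using diff_left[OF w(1) ceV] scaleR_left[OF e(1)] w(3) e(3) that subsetD[OF spanV that] by simp
  have "ip ?w u = 0" if u: "u \<in> span (insert b B)" for u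
  proof -
    obtain a where a: "u - a *\<^sub>R b \<in> span B"
      using u span_breakdown_eq by blast
    \<comment> \<open>Modulo \<open>span B\<close> the vector \<open>b\<close> may be replaced by
      \<open>e\<close>. Thus \<open>u\<close> splits into \<open>r\<close> in \<open>span B\<close>
      and a multiple of \<open>e\<close>, and \<open>?w\<close> is orthogonal to both.\<close>
    define r where "r = (u - a *\<^sub>R b) + a *\<^sub>R (b - e)"
    have r: "r \<in> span B"
      unfolding r_def using a e(2) by (intro span_add span_scale)
    have u_eq: "u = r + a *\<^sub>R e"
      by (simp add: r_def scaleR_diff_right)
    show ?thesis
      unfolding u_eq
      using add_right[OF _ subspace_scale[OF subspace_V e(1)] wV, of r a] scaleR_right[OF e(1) wV, of a]
        wB[OF r] we subsetD[OF spanV r]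
      by simp
  qed
  moreover have "v - ?w \<in> span (insert b B)"
  proof -
    \<comment> \<open>Here \<open>e\<close> is written as \<open>b - (b - e)\<close> to exhibit it
      as an element of \<open>span (insert b B)\<close>.\<close>
    have "v - ?w = (v - w) + c *\<^sub>R (b - (b - e))"
      by simp
    also have "\<dots> \<in> span (insert b B)"
    proof (rule span_add)
      show "v - w \<in> span (insert b B)"
        by (rule subsetD[OF span_mono[OF subset_insertI] w(2)])
      have "b - (b - e) \<in> span (insert b B)"
        by (rule span_diff[OF span_base subsetD[OF span_mono[OF subset_insertI] e(2)]]) simp
      then show "c *\<^sub>R (b - (b - e)) \<in> span (insert b B)"
        by (rule span_scale)
    qed
    finally show ?thesis .
  qed
  ultimately show ?case
    using wV by blast
qed

end

section \<open>The projection onto the orthogonal complement of a distribution\<close>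

lemma riemannian_metric_partial_inner_product:
  assumes "riemannian_metric M g" "p \<in> points M"
  shows "partial_inner_product (tangent_space M p) (g p)"
proof
  show "subspace (tangent_space M p)"
    by (rule subspace_tangent_space)
qed (use assms in \<open>simp_all add: riemannian_metric_def\<close>)

text \<open>\<open>proj_perp\<close> is a definite description, so its defining property becomes
  available only after existence and uniqueness of the orthogonal component.\<close>

lemma proj_perp_decomposition:
  assumes "riemannian_metric M g" and "regular_distribution M D"
    and p: "p \<in> points M" and v: "v \<in> tangent_space M p"
  shows "v - proj_perp M g D p v \<in> D p"
proof -
  interpret partial_inner_product "tangent_space M p" "g p"
    using riemannian_metric_partial_inner_product[OF assms(1) p] .
  have D: "subspace (D p)" "D p \<subseteq> tangent_space M p"
    using assms(2) p unfolding regular_distribution_def by blast+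
  \<comment> \<open>\<open>B\<close> consists of the values at \<open>p\<close> of a local frame
    around \<open>p\<close>.\<close>
  obtain B where B: "finite B" "D p = span B"
    using assms(2) p unfolding regular_distribution_def by (metis finite_imageI finite_lessThan)
  have "B \<subseteq> tangent_space M p"
    using B D span_superset by blast
  then obtain w where w: "w \<in> perp M g D p \<and> v - w \<in> D p"
    using orthogonal_exists[OF B(1) _ v] B(2) unfolding perp_def by auto
  have "w' = w" if "w' \<in> perp M g D p \<and> v - w' \<in> D p" for w'
    using that w unfolding perp_def by (intro orthogonal_unique[OF D, of v]) blast+
  then have "proj_perp M g D p v = w"
    unfolding proj_perp_def using w by (intro the_equality)
  then show ?thesis
    using w by simp
qed

text \<open>Comparing decompositions modulo \<open>D p\<close> takes the place of linearity of the
  projection. If the projections agree, subtracting the two decompositions cancels them.\<close>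

lemma proj_perp_eq_iff:
  assumes "riemannian_metric M g" and "regular_distribution M D" and "p \<in> points M"
    and "v \<in> tangent_space M p" "v' \<in> tangent_space M p"
  shows "proj_perp M g D p v = proj_perp M g D p v' \<longleftrightarrow> v - v' \<in> D p"
proof
  have D: "subspace (D p)"
    using assms unfolding regular_distribution_def by blast
  {
    assume "proj_perp M g D p v = proj_perp M g D p v'"
    then show "v - v' \<in> D p"
      using subspace_diff[OF D proj_perp_decomposition[OF assms(1-4)]
          proj_perp_decomposition[OF assms(1-3,5)]]
      by simp
  next
    assume vv': "v - v' \<in> D p"
    \<comment> \<open>The two descriptions thus have equivalent predicates and denote the same
      vector.\<close>
    have "v - w \<in> D p \<longleftrightarrow> v' - w \<in> D p" for w
      using subspace_add[OF D vv', of "v' - w"] subspace_diff[OF D _ vv', of "v - w"] by auto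
    then show "proj_perp M g D p v = proj_perp M g D p v'"
      unfolding proj_perp_def by simp
  }
qed

theorem corollary13:
  fixes M :: "'a manifold"
    and g :: "'a \<Rightarrow> 'a tangent \<Rightarrow> 'a tangent \<Rightarrow> real"
    and nabla :: "'a vfield \<Rightarrow> 'a vfield \<Rightarrow> 'a vfield"
    and D :: "'a \<Rightarrow> 'a tangent set"
  assumes "smooth_manifold M"
    and "riemannian_metric M g"
    and "levi_civita_connection M g nabla"
    and "regular_distribution M D"
  shows "involutive M D \<longleftrightarrow>
    (\<forall>X\<in>sections M D. \<forall>Y\<in>sections M D.
       second_fundamental_form M g nabla D X Y = second_fundamental_form M g nabla D Y X)"
  unfolding involutive_def
\<comment> \<open>The equivalence already holds for each single pair \<open>X\<close>,
  \<open>Y\<close>.\<close>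
proof (intro ball_cong refl)
  fix X Y
  assume "X \<in> sections M D" "Y \<in> sections M D"
  then have XY: "X \<in> vector_fields M" "Y \<in> vector_fields M"
    by (auto simp: sections_def)
  then have nabla: "nabla X Y \<in> vector_fields M" "nabla Y X \<in> vector_fields M"
    and bracket: "lie_bracket X Y = nabla X Y - nabla Y X"
    using assms(3) unfolding levi_civita_connection_def affine_connection_def by auto
  have tangent: "nabla X Y p \<in> tangent_space M p" "nabla Y X p \<in> tangent_space M p"
    if "p \<in> points M" for p
    using nabla that by (auto simp: vector_fields_def smooth_vfield_on_def)
  \<comment> \<open>The bracket is a smooth vector field as a difference of two such fields, so only
    the pointwise condition of being a section remains.\<close>
  have "lie_bracket X Y \<in> sections M D \<longleftrightarrow> (\<forall>p\<in>points M. nabla X Y p - nabla Y X p \<in> D p)"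
    using vector_fields_diff[OF assms(1) nabla] by (simp add: sections_def bracket)
  also have "\<dots> \<longleftrightarrow> (\<forall>p\<in>points M.
      proj_perp M g D p (nabla X Y p) = proj_perp M g D p (nabla Y X p))"
    using proj_perp_eq_iff[OF assms(2,4)] tangent by simp
  \<comment> \<open>Off the manifold both forms have the default value \<open>0\<close>, so equality
    on \<open>points M\<close> is equality of functions.\<close>
  also have "\<dots> \<longleftrightarrow>
      second_fundamental_form M g nabla D X Y = second_fundamental_form M g nabla D Y X"
    by (auto simp: second_fundamental_form_def fun_eq_iff)
  finally show "lie_bracket X Y \<in> sections M D \<longleftrightarrow>
      second_fundamental_form M g nabla D X Y = second_fundamental_form M g nabla D Y X" .
qed

end
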